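(* Let $N$ be a finite nonempty set of players. The Banzhaf–Owen value $\Psi$ satisfies the properties of additivity, null player and necessary players get the coalitional mean, and it is the unique coalitional value $g:\mathcal{G}_N^{cs}\to\mathbb{R}^N$ that satisfies these three properties.
   Context: Fix a finite nonempty set $N$. A cooperative game with player set $N$ is a pair $(N,v)$ with $v:2^N\to\mathbb{R}$, $v(\emptyset)=0$. A coalition structure on $N$ is a partition $P=\{P_1,\dots,P_m\}$ of $N$ into nonempty sets (unions); $M=\{1,\dots,m\}$, $p_k=|P_k|$. A cooperative game with a coalition structure is a triple $(N,v,P)$; $\mathcal{G}_N^{cs}$ is the set of all of them (all $v$, all $P$). A coalitional value is a map $g$ assigning to each $(N,v,P)\in\mathcal{G}_N^{cs}$ a vector $g(N,v,P)\in\mathbb{R}^N$. For $R\subseteq M$ write $P_R=\bigcup_{l\in R}P_l$. The Banzhaf–Owen value is, for $i\in P_k$, $$\Psi_i(N,v,P)=\frac{1}{2^{m-1}}\frac{1}{2^{p_k-1}}\sum_{R\subseteq M\setminus\{k\}}\ \sum_{T\subseteq P_k\setminus\{i\}}\bigl[v(P_R\cup T\cup\{i\})-v(P_R\cup T)\bigr].$$ A player $i$ is null in $(N,v)$ if $v(S\cup\{i\})=v(S)$ for all $S\subseteq N\setminus\{i\}$, and necessary in $(N,v)$ if $v(S)=0$ for all $S\subseteq N\setminus\{i\}$. Properties of a coalitional value $g$: - Additivity: $g(N,v+w,P)=g(N,v,P)+g(N,w,P)$ for all $v,w,P$. - Null player: $g_i(N,v,P)=0$ for all $(N,v,P)$ and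 every null player $i$ of $(N,v)$. - Necessary players get the coalitional mean: for every $(N,v,P)$ and every player $i\in P_k$ necessary in $(N,v)$, $$g_i(N,v,P)=\frac{1}{2^{m-1}}\frac{1}{2^{p_k-1}}\sum_{R\subseteq M\setminus\{k\}}\ \sum_{T\subseteq P_k}v(P_R\cup T).$$ *)

theory Defs
  imports Complex_Main "HOL-Library.FuncSet" "HOL-Library.Disjoint_Sets"
begin

text \<open>
  Maps with domain \<open>2\<^sup>N\<close>, with domain \<open>\<G>\<^sub>N\<close>, and into \<open>\<real>\<^sup>N\<close> are encoded as extensional
  functions, so that HOL equality of such maps is equality on the intended domain.
\<close>

definition games :: "'a set \<Rightarrow> ('a set \<Rightarrow> real) set" where
  "games N = {v \<in> Pow N \<rightarrow>\<^sub>E UNIV. v {} = 0}"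

definition game_add :: "'a set \<Rightarrow> ('a set \<Rightarrow> real) \<Rightarrow> ('a set \<Rightarrow> real) \<Rightarrow> ('a set \<Rightarrow> real)" where
  "game_add N v w = (\<lambda>S\<in>Pow N. v S + w S)"

definition cs_games :: "'a set \<Rightarrow> (('a set \<Rightarrow> real) \<times> 'a set set) set" where
  "cs_games N = games N \<times> {P. partition_on N P}"

type_synonym 'a coalitional_value = "('a set \<Rightarrow> real) \<times> 'a set set \<Rightarrow> 'a \<Rightarrow> real"

definition coalitional_values :: "'a set \<Rightarrow> 'a coalitional_value set" where
  "coalitional_values N = cs_games N \<rightarrow>\<^sub>E (N \<rightarrow>\<^sub>E UNIV)"

definition union_of :: "'a set set \<Rightarrow> 'a \<Rightarrow> 'a set" where
  "union_of P i = (THE B. B \<in> P \<and> i \<in> B)"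

text \<open>
  The unions are not numbered: a set of indices \<open>R \<subseteq> M - {k}\<close> becomes a subfamily
  \<open>R \<subseteq> P - {B}\<close> with \<open>B = P\<^sub>k\<close>, so that \<open>P\<^sub>R\<close> is \<open>\<Union>R\<close> and \<open>m\<close> is \<open>card P\<close>.
\<close>

definition banzhaf_owen :: "'a set \<Rightarrow> 'a coalitional_value" where
  "banzhaf_owen N = (\<lambda>(v, P)\<in>cs_games N. \<lambda>i\<in>N.
     (let B = union_of P i in
       1 / 2 ^ (card P - 1) * (1 / 2 ^ (card B - 1)) *
         (\<Sum>R\<in>Pow (P - {B}). \<Sum>T\<in>Pow (B - {i}).
            v (\<Union>R \<union> T \<union> {i}) - v (\<Union>R \<union> T))))"

definition null_player :: "'a set \<Rightarrow> ('a set \<Rightarrow> real) \<Rightarrow> 'a \<Rightarrow> bool" where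
  "null_player N v i \<longleftrightarrow> i \<in> N \<and> (\<forall>S. S \<subseteq> N - {i} \<longrightarrow> v (S \<union> {i}) = v S)"

definition necessary_player :: "'a set \<Rightarrow> ('a set \<Rightarrow> real) \<Rightarrow> 'a \<Rightarrow> bool" where
  "necessary_player N v i \<longleftrightarrow> i \<in> N \<and> (\<forall>S. S \<subseteq> N - {i} \<longrightarrow> v S = 0)"

definition additivity :: "'a set \<Rightarrow> 'a coalitional_value \<Rightarrow> bool" where
  "additivity N g \<longleftrightarrow>
     (\<forall>v\<in>games N. \<forall>w\<in>games N. \<forall>P. partition_on N P \<longrightarrow>
        (\<forall>i\<in>N. g (game_add N v w, P) i = g (v, P) i + g (w, P) i))"

definition null_player_property :: "'a set \<Rightarrow> 'a coalitional_value \<Rightarrow> bool" where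
  "null_player_property N g \<longleftrightarrow>
     (\<forall>(v, P)\<in>cs_games N. \<forall>i. null_player N v i \<longrightarrow> g (v, P) i = 0)"

definition necessary_players_coalitional_mean :: "'a set \<Rightarrow> 'a coalitional_value \<Rightarrow> bool" where
  "necessary_players_coalitional_mean N g \<longleftrightarrow>
     (\<forall>(v, P)\<in>cs_games N. \<forall>B\<in>P. \<forall>i\<in>B. necessary_player N v i \<longrightarrow>
        g (v, P) i =
          1 / 2 ^ (card P - 1) * (1 / 2 ^ (card B - 1)) *
            (\<Sum>R\<in>Pow (P - {B}). \<Sum>T\<in>Pow B. v (\<Union>R \<union> T)))"

end

theory Submission
  imports Defs
begin

text \<open>
  For uniqueness, fix a player \<open>i\<close> and write \<open>v S = v (S - {i}) + (v S - v (S - {i}))\<close>.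
  In the first summand \<open>i\<close> is null and in the second \<open>i\<close> is necessary, so the three properties
  determine the payoff of \<open>i\<close> in \<open>v\<close>; no expansion in unanimity games is needed.
\<close>

text \<open>Subsets of \<open>B\<close> that contain \<open>i\<close> arise injectively by inserting
  \<open>i\<close> into those that avoid it. This links the sum over \<open>Pow B\<close> in the
  coalitional mean to the sum over \<open>Pow (B - {i})\<close> in the Banzhaf-Owen value.\<close>

lemma sum_Pow_split:
  fixes f :: "'a set \<Rightarrow> 'b::comm_monoid_add"
  assumes "finite B" and "i \<in> B"
  shows "(\<Sum>T\<in>Pow B. f T) = (\<Sum>T\<in>Pow (B - {i}). f T) + (\<Sum>T\<in>Pow (B - {i}). f (insert i T))"
proof -
  have "Pow B = Pow (B - {i}) \<union> insert i ` Pow (B - {i})"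
    using Pow_insert[of i "B - {i}"] assms(2) by (simp add: insert_absorb)
  moreover have "inj_on (insert i) (Pow (B - {i}))"
    by (rule inj_onI) (metis DiffD2 PowD insertI1 insert_ident subsetD)
  moreover have "Pow (B - {i}) \<inter> insert i ` Pow (B - {i}) = {}"
    by auto
  ultimately show ?thesis
    using assms(1) by (simp add: sum.union_disjoint sum.reindex)
qed

lemma union_of_eq:
  assumes "partition_on N P" and "B \<in> P" and "i \<in> B"
  shows "union_of P i = B"
  unfolding union_of_def
proof (rule the_equality)
  show "C = B" if "C \<in> P \<and> i \<in> C" for C
    using that assms disjointD[OF partition_onD2[OF assms(1)]] by blast
qed (use assms in blast)

text \<open>Working form of the definition: with a block \<open>B\<close> containing
  \<open>i\<close> at hand, neither the description operator in \<open>union_of\<close> nor the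
  restrictions to \<open>cs_games N\<close> and \<open>N\<close> appear in later proofs.\<close>

lemma banzhaf_owen_eq:
  assumes "v \<in> games N" and "partition_on N P" and "B \<in> P" and "i \<in> B"
  shows "banzhaf_owen N (v, P) i = 1 / 2 ^ (card P - 1) * (1 / 2 ^ (card B - 1)) *
    (\<Sum>R\<in>Pow (P - {B}). \<Sum>T\<in>Pow (B - {i}). v (\<Union>R \<union> T \<union> {i}) - v (\<Union>R \<union> T))"
proof -
  have "i \<in> N"
    using assms partition_onD1 by blast
  then show ?thesis
    using assms by (simp add: banzhaf_owen_def cs_games_def union_of_eq Let_def)
qed

text \<open>Blocks are disjoint, so \<open>B\<close> is the only one containing \<open>i\<close>.
  Hence the coalitions in the double sum fall under the quantifier over
  \<open>S \<subseteq> N - {i}\<close> in the definitions of null and necessary players.\<close>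

lemma Union_without_player:
  assumes "partition_on N P" and "B \<in> P" and "i \<in> B"
    and "R \<subseteq> P - {B}" and "T \<subseteq> B - {i}"
  shows "\<Union>R \<union> T \<subseteq> N - {i}"
proof -
  have "i \<notin> C" if "C \<in> R" for C
    using that assms disjointD[OF partition_onD2[OF assms(1)], of C B] by blast
  then show ?thesis
    using assms partition_onD1[OF assms(1)] by blast
qed

lemma partition_on_obtain:
  assumes "partition_on N P" and "i \<in> N"
  obtains B where "B \<in> P" and "i \<in> B"
  using assms partition_onD1 by blast

lemma game_add_in_games:
  assumes "v \<in> games N" and "w \<in> games N"
  shows "game_add N v w \<in> games N"
  using assms by (auto simp: games_def game_add_def)

lemma banzhaf_owen_coalitional_value: "banzhaf_owen N \<in> coalitional_values N"
  by (auto simp: banzhaf_owen_def coalitional_values_def)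

lemma banzhaf_owen_additivity: "additivity N (banzhaf_owen N)"
  unfolding additivity_def
proof (intro ballI allI impI)
  fix v w P i
  assume v: "v \<in> games N" and w: "w \<in> games N" and P: "partition_on N P" and i: "i \<in> N"
  obtain B where B: "B \<in> P" "i \<in> B"
    using P i by (rule partition_on_obtain)
  have "(\<Sum>R\<in>Pow (P - {B}). \<Sum>T\<in>Pow (B - {i}).
      game_add N v w (\<Union>R \<union> T \<union> {i}) - game_add N v w (\<Union>R \<union> T)) =
    (\<Sum>R\<in>Pow (P - {B}). \<Sum>T\<in>Pow (B - {i}).
      (v (\<Union>R \<union> T \<union> {i}) - v (\<Union>R \<union> T)) + (w (\<Union>R \<union> T \<union> {i}) - w (\<Union>R \<union> T)))"
  proof (intro sum.cong refl)
    fix R T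
    assume "R \<in> Pow (P - {B})" and "T \<in> Pow (B - {i})"
    then have "\<Union>R \<union> T \<subseteq> N - {i}"
      using Union_without_player[OF P B] by simp
    \<comment> \<open>\<open>game_add N v w\<close> is the pointwise sum only on
      \<open>Pow N\<close>, so both coalitions must be placed there before unfolding.\<close>
    then have "\<Union>R \<union> T \<in> Pow N" and "\<Union>R \<union> T \<union> {i} \<in> Pow N"
      using i by auto
    then show "game_add N v w (\<Union>R \<union> T \<union> {i}) - game_add N v w (\<Union>R \<union> T) =
      (v (\<Union>R \<union> T \<union> {i}) - v (\<Union>R \<union> T)) + (w (\<Union>R \<union> T \<union> {i}) - w (\<Union>R \<union> T))"
      unfolding game_add_def by (simp only: restrict_apply')
  qed
  then show "banzhaf_owen N (game_add N v w, P) i =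
      banzhaf_owen N (v, P) i + banzhaf_owen N (w, P) i"
    \<comment> \<open>The coefficients depend only on \<open>P\<close> and \<open>B\<close>, hence
      are the same for all three games.\<close>
    by (simp only: banzhaf_owen_eq[OF _ P B] game_add_in_games v w sum.distrib distrib_left)
qed

lemma banzhaf_owen_null_player: "null_player_property N (banzhaf_owen N)"
  unfolding null_player_property_def
proof (clarify)
  fix v P i
  assume "(v, P) \<in> cs_games N" and null: "null_player N v i"
  then have v: "v \<in> games N" and P: "partition_on N P" and i: "i \<in> N"
    by (auto simp: cs_games_def null_player_def)
  obtain B where B: "B \<in> P" "i \<in> B"
    using P i by (rule partition_on_obtain)
  have "v (\<Union>R \<union> T \<union> {i}) = v (\<Union>R \<union> T)" if "R \<in> Pow (P - {B})" and "T \<in> Pow (B - {i})" for R T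
    using null Union_without_player[OF P B] that unfolding null_player_def by simp
  then have "(\<Sum>R\<in>Pow (P - {B}). \<Sum>T\<in>Pow (B - {i}). v (\<Union>R \<union> T \<union> {i}) - v (\<Union>R \<union> T)) = 0"
    by (intro sum.neutral ballI) simp
  then show "banzhaf_owen N (v, P) i = 0"
    by (simp only: banzhaf_owen_eq[OF v P B] mult_zero_right)
qed

text \<open>For a necessary player \<open>i\<close>, coalitions without \<open>i\<close> are worth
  0. Each marginal contribution is then just the worth of the coalition with \<open>i\<close>, and
  only such coalitions contribute to the sum over \<open>Pow B\<close>.\<close>

lemma banzhaf_owen_necessary_players:
  assumes "finite N"
  shows "necessary_players_coalitional_mean N (banzhaf_owen N)"
  unfolding necessary_players_coalitional_mean_def
proof (clarify)
  fix v P B i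
  assume "(v, P) \<in> cs_games N" and B: "B \<in> P" "i \<in> B" and nec: "necessary_player N v i"
  then have v: "v \<in> games N" and P: "partition_on N P"
    by (auto simp: cs_games_def)
  have "finite B"
    using assms B P partition_onD1 by (metis Union_upper finite_subset)
  have "(\<Sum>T\<in>Pow (B - {i}). v (\<Union>R \<union> T \<union> {i}) - v (\<Union>R \<union> T)) = (\<Sum>T\<in>Pow B. v (\<Union>R \<union> T))"
    if "R \<in> Pow (P - {B})" for R
  proof -
    have "v (\<Union>R \<union> T) = 0" if "T \<in> Pow (B - {i})" for T
      using nec Union_without_player[OF P B] that \<open>R \<in> _\<close> unfolding necessary_player_def by simp
    then show ?thesis
      by (simp add: sum_Pow_split[OF \<open>finite B\<close> B(2)])
  qed
  then show "banzhaf_owen N (v, P) i = 1 / 2 ^ (card P - 1) * (1 / 2 ^ (card B - 1)) *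
      (\<Sum>R\<in>Pow (P - {B}). \<Sum>T\<in>Pow B. v (\<Union>R \<union> T))"
    by (simp only: banzhaf_owen_eq[OF v P B] cong: sum.cong)
qed

lemma null_necessary_decomposition:
  assumes v: "v \<in> games N" and i: "i \<in> N"
  obtains v0 v1 where "v0 \<in> games N" and "v1 \<in> games N" and "v = game_add N v0 v1"
    and "null_player N v0 i" and "necessary_player N v1 i"
proof
  let ?v0 = "\<lambda>S\<in>Pow N. v (S - {i})"
  let ?v1 = "\<lambda>S\<in>Pow N. v S - v (S - {i})"
  \<comment> \<open>Both vanish at \<open>{}\<close> because \<open>{} - {i} = {}\<close>.\<close>
  show "?v0 \<in> games N" and "?v1 \<in> games N"
    using v by (auto simp: games_def)
  show "v = game_add N ?v0 ?v1"
  proof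
    \<comment> \<open>The equation is between total functions: if \<open>S\<close> is not a subset
      of \<open>N\<close>, both sides are \<open>undefined\<close>, for \<open>v\<close> by its
      extensionality.\<close>
    show "v S = game_add N ?v0 ?v1 S" for S
      using v PiE_arb[of v "Pow N" "\<lambda>_. UNIV" S] by (simp add: games_def game_add_def)
  qed
  show "null_player N ?v0 i"
    using i by (auto simp: null_player_def)
  show "necessary_player N ?v1 i"
    unfolding necessary_player_def
  proof (intro conjI allI impI i)
    fix S
    assume "S \<subseteq> N - {i}"
    then have "S - {i} = S" and "S \<subseteq> N"
      by auto
    then show "?v1 S = 0"
      by simp
  qed
qed

text \<open>The null player and coalitional mean properties prescribe payoffs by expressions that do
  not involve the value itself, so any two values with these properties agree on both summands of
  the decomposition, and additivity joins them.\<close>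

lemma coalitional_value_unique:
  assumes g: "g \<in> coalitional_values N" "additivity N g" "null_player_property N g"
      "necessary_players_coalitional_mean N g"
    and h: "h \<in> coalitional_values N" "additivity N h" "null_player_property N h"
      "necessary_players_coalitional_mean N h"
  shows "g = h"
proof -
  \<comment> \<open>The decomposition of \<open>v\<close> depends on \<open>i\<close>, so agreement
    is shown one component at a time.\<close>
  have agree: "g (v, P) i = h (v, P) i"
    if v: "v \<in> games N" and P: "partition_on N P" and i: "i \<in> N" for v P i
  proof -
    obtain B where B: "B \<in> P" "i \<in> B"
      using P i by (rule partition_on_obtain)
    obtain v0 v1 where v01: "v0 \<in> games N" "v1 \<in> games N" and v_eq: "v = game_add N v0 v1"
      and null: "null_player N v0 i" and nec: "necessary_player N v1 i"
      using v i by (rule null_necessary_decomposition)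
    have cs: "(v0, P) \<in> cs_games N" "(v1, P) \<in> cs_games N"
      using v01 P by (auto simp: cs_games_def)
    have "g (v0, P) i = h (v0, P) i"
      using bspec[OF g(3)[unfolded null_player_property_def] cs(1)]
        bspec[OF h(3)[unfolded null_player_property_def] cs(1)] null by simp
    moreover have "g (v1, P) i = h (v1, P) i"
      using bspec[OF g(4)[unfolded necessary_players_coalitional_mean_def] cs(2)]
        bspec[OF h(4)[unfolded necessary_players_coalitional_mean_def] cs(2)] B nec by simp
    ultimately show ?thesis
      using g(2) h(2) v01 P i unfolding v_eq additivity_def by simp
  qed
  \<comment> \<open>Extensionality is used twice: on \<open>cs_games N\<close> for the values, then
    on \<open>N\<close> for the payoff vectors.\<close>
  show ?thesis
  proof (rule PiE_ext)
    show "g \<in> cs_games N \<rightarrow>\<^sub>E (N \<rightarrow>\<^sub>E UNIV)" and "h \<in> cs_games N \<rightarrow>\<^sub>E (N \<rightarrow>\<^sub>E UNIV)"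
      using g(1) h(1) by (simp_all add: coalitional_values_def)
    then show "g x = h x" if "x \<in> cs_games N" for x
      using that agree by (intro PiE_ext[of "g x" N "\<lambda>_. UNIV" "h x"]) (auto simp: cs_games_def)
  qed
qed

theorem theorem9:
  fixes N :: "'a set"
  assumes "finite N" and "N \<noteq> {}"
  shows "banzhaf_owen N \<in> coalitional_values N \<and>
    additivity N (banzhaf_owen N) \<and>
    null_player_property N (banzhaf_owen N) \<and>
    necessary_players_coalitional_mean N (banzhaf_owen N) \<and>
    (\<forall>g\<in>coalitional_values N.
       additivity N g \<and> null_player_property N g \<and> necessary_players_coalitional_mean N g
         \<longrightarrow> g = banzhaf_owen N)"
proof (intro conjI ballI impI)
  note bo = banzhaf_owen_coalitional_value[of N] banzhaf_owen_additivity[of N]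
    banzhaf_owen_null_player[of N] banzhaf_owen_necessary_players[OF assms(1)]
  show "banzhaf_owen N \<in> coalitional_values N" and "additivity N (banzhaf_owen N)"
    and "null_player_property N (banzhaf_owen N)"
    and "necessary_players_coalitional_mean N (banzhaf_owen N)"
    by (fact bo)+
  show "g = banzhaf_owen N"
    if "g \<in> coalitional_values N" and "additivity N g \<and> null_player_property N g \<and>
      necessary_players_coalitional_mean N g" for g
    \<comment> \<open>The four facts in \<open>bo\<close>, in this order, are the premises on the
      second value \<open>h\<close>.\<close>
    using coalitional_value_unique[OF that(1) _ _ _ bo] that(2) by simp
qed

end
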